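(* Let $m,n,x,y$ be positive integers. The quadratic forms $\langle n, nx^2\rangle$ and $\langle m, my^2\rangle$ are similar over $\mathbb{Q}$ if and only if $(n,nx^2)_p=(m,my^2)_p$ for every odd prime $p$.
   Context: $\langle a_1,a_2\rangle$ denotes the quadratic form on $\mathbb{Q}^2$ with matrix $\mathrm{diag}(a_1,a_2)$; two quadratic forms with symmetric matrices $Q_1,Q_2$ are similar over $\mathbb{Q}$ if $A^{\top}Q_2A=Q_1$ for some invertible rational matrix $A$. For nonzero rationals $a,b$ and a prime $p$, the Hilbert symbol $(a,b)_p$ equals $1$ if the equation $ax^2+by^2=z^2$ has a solution $(x,y,z)\neq(0,0,0)$ in the field $\mathbb{Q}_p$ of $p$-adic numbers, and $-1$ otherwise. *)

theory Defs
  imports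
    "HOL-Analysis.Cartesian_Space"
    "HOL-Algebra.QuotRing"
    "HOL-Computational_Algebra.Primes"
begin

section \<open>Binary quadratic forms over the rationals\<close>

text \<open>A quadratic form on $\mathbb{Q}^n$ is represented by its symmetric matrix.\<close>

definition diag_form :: "rat \<Rightarrow> rat \<Rightarrow> rat^2^2" where
  "diag_form a b = vector [vector [a, 0], vector [0, b]]"

definition similar_over_Q :: "rat^'n^'n \<Rightarrow> rat^'n^'n \<Rightarrow> bool" where
  "similar_over_Q Q1 Q2 \<longleftrightarrow>
     (\<exists>A :: rat^'n^'n. invertible A \<and> transpose A ** Q2 ** A = Q1)"


section \<open>The field of p-adic numbers\<close>

text \<open>
  $\mathbb{Q}_p$ is the completion of $\mathbb{Q}$ with respect to the $p$-adic absolute value: the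
  ring of $p$-adic Cauchy sequences of rationals modulo the ideal of $p$-adic null sequences. As
  $p$ is a variable, it is a ring in the sense of HOL-Algebra and not a type.
\<close>

definition padic_val :: "nat \<Rightarrow> rat \<Rightarrow> int" where
  "padic_val p q = int (multiplicity (int p) (fst (quotient_of q)))
                 - int (multiplicity (int p) (snd (quotient_of q)))"

definition padic_abs :: "nat \<Rightarrow> rat \<Rightarrow> real" where
  "padic_abs p q = (if q = 0 then 0 else real p powi (- padic_val p q))"

definition padic_Cauchy :: "nat \<Rightarrow> (nat \<Rightarrow> rat) \<Rightarrow> bool" where
  "padic_Cauchy p s \<longleftrightarrow> (\<forall>e>0. \<exists>N. \<forall>i\<ge>N. \<forall>j\<ge>N. padic_abs p (s i - s j) < e)"

definition padic_null :: "nat \<Rightarrow> (nat \<Rightarrow> rat) set" where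
  "padic_null p = {s. (\<lambda>i. padic_abs p (s i)) \<longlonglongrightarrow> 0}"

definition padic_Cauchy_ring :: "nat \<Rightarrow> (nat \<Rightarrow> rat) ring" where
  "padic_Cauchy_ring p =
     \<lparr>carrier = {s. padic_Cauchy p s}, monoid.mult = (\<lambda>s t i. s i * t i), one = (\<lambda>i. 1),
      zero = (\<lambda>i. 0), add = (\<lambda>s t i. s i + t i)\<rparr>"

definition padic_field :: "nat \<Rightarrow> (nat \<Rightarrow> rat) set ring" where
  "padic_field p = padic_Cauchy_ring p Quot padic_null p"

text \<open>The canonical embedding $\mathbb{Q} \to \mathbb{Q}_p$, by constant sequences:\<close>

definition padic_of_rat :: "nat \<Rightarrow> rat \<Rightarrow> (nat \<Rightarrow> rat) set" where
  "padic_of_rat p q = padic_null p +>\<^bsub>padic_Cauchy_ring p\<^esub> (\<lambda>i. q)"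


section \<open>The Hilbert symbol\<close>

definition Hilbert_symbol :: "rat \<Rightarrow> rat \<Rightarrow> nat \<Rightarrow> int" where
  "Hilbert_symbol a b p =
     (let K = padic_field p in
      if \<exists>x\<in>carrier K. \<exists>y\<in>carrier K. \<exists>z\<in>carrier K.
           (x, y, z) \<noteq> (\<zero>\<^bsub>K\<^esub>, \<zero>\<^bsub>K\<^esub>, \<zero>\<^bsub>K\<^esub>) \<and>
           (padic_of_rat p a \<otimes>\<^bsub>K\<^esub> x [^]\<^bsub>K\<^esub> (2::nat)) \<oplus>\<^bsub>K\<^esub> (padic_of_rat p b \<otimes>\<^bsub>K\<^esub> y [^]\<^bsub>K\<^esub> (2::nat))
             = z [^]\<^bsub>K\<^esub> (2::nat)
      then 1 else - 1)"


section \<open>The quotient is indeed a field\<close>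

lemma padic_abs_0 [simp]: "padic_abs p 0 = 0"
  by (simp add: padic_abs_def)

lemma padic_abs_1 [simp]: "padic_abs p 1 = 1"
  by (simp add: padic_abs_def padic_val_def)

lemma padic_abs_nonneg [simp]: "padic_abs p a \<ge> 0"
  by (simp add: padic_abs_def)

lemma padic_abs_minus [simp]: "padic_abs p (- a) = padic_abs p a"
proof -
  have "multiplicity (int p) (- x) = multiplicity (int p) x" for x
    using multiplicity_times_unit_right[of "-1" "int p" x] by simp
  thus ?thesis
    by (simp add: padic_abs_def padic_val_def rat_uminus_code case_prod_unfold Let_def)
qed

context
  fixes p :: nat
  assumes p: "prime p"
begin

lemma padic_prime_elem: "prime_elem (int p)"
  using p by simp

lemma padic_abs_eq_0_iff: "padic_abs p a = 0 \<longleftrightarrow> a = 0"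
  using p by (auto simp: padic_abs_def prime_gt_0_nat)

lemma padic_val_divide:
  assumes "x \<noteq> 0" "d \<noteq> 0"
  shows "padic_val p (of_int x / of_int d) =
           int (multiplicity (int p) x) - int (multiplicity (int p) d)"
proof -
  obtain a b where ab: "quotient_of (of_int x / of_int d) = (a, b)"
    by fastforce
  have b: "b > 0"
    using quotient_of_denom_pos[OF ab] .
  have eq: "(of_int x / of_int d :: rat) = of_int a / of_int b"
    using quotient_of_div[OF ab] .
  have a: "a \<noteq> 0"
    using eq assms b by auto
  have "(of_int (x * b) :: rat) = of_int (a * d)"
    using eq assms b by (simp add: field_simps)
  hence "x * b = a * d"
    by (simp only: of_int_eq_iff)
  hence "multiplicity (int p) (x * b) = multiplicity (int p) (a * d)"
    by simp
  thus ?thesis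
    using a b assms ab
    by (simp add: padic_val_def prime_elem_multiplicity_mult_distrib[OF padic_prime_elem])
qed

lemma padic_abs_mult: "padic_abs p (a * b) = padic_abs p a * padic_abs p b"
proof (cases "a = 0 \<or> b = 0")
  case False
  obtain x d where a: "a = of_int x / of_int d" "d \<noteq> 0"
    by (metis quotient_of_div quotient_of_denom_pos surj_pair less_irrefl)
  obtain y e where b: "b = of_int y / of_int e" "e \<noteq> 0"
    by (metis quotient_of_div quotient_of_denom_pos surj_pair less_irrefl)
  have nz: "x \<noteq> 0" "y \<noteq> 0"
    using False a b by auto
  have ab: "a * b = of_int (x * y) / of_int (d * e)"
    by (simp add: a b)
  have "padic_val p (a * b) = padic_val p a + padic_val p b"
    unfolding ab using nz a b
    by (simp only: padic_val_divide mult_eq_0_iff de_Morgan_disj simp_thms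
        prime_elem_multiplicity_mult_distrib[OF padic_prime_elem])
  moreover have "real p \<noteq> 0"
    using p by (simp add: prime_gt_0_nat)
  ultimately show ?thesis
    using False by (simp add: padic_abs_def power_int_diff power_int_minus field_simps)
qed auto

lemma padic_abs_add: "padic_abs p (a + b) \<le> max (padic_abs p a) (padic_abs p b)"
proof (cases "a = 0 \<or> b = 0 \<or> a + b = 0")
  case False
  obtain x0 d0 where a: "a = of_int x0 / of_int d0" "d0 \<noteq> 0"
    by (metis quotient_of_div quotient_of_denom_pos surj_pair less_irrefl)
  obtain y0 e0 where b: "b = of_int y0 / of_int e0" "e0 \<noteq> 0"
    by (metis quotient_of_div quotient_of_denom_pos surj_pair less_irrefl)
  define x y d where "x = x0 * e0" and "y = y0 * d0" and "d = d0 * e0"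
  have d: "d \<noteq> 0"
    using a b by (simp add: d_def)
  have a': "a = of_int x / of_int d" and b': "b = of_int y / of_int d"
    using a b by (simp_all add: x_def y_def d_def)
  have ab': "a + b = of_int (x + y) / of_int d"
    by (simp add: a' b' add_divide_distrib)
  have nz: "x \<noteq> 0" "y \<noteq> 0" "x + y \<noteq> 0"
    using False a' b' ab' by auto
  let ?m = "multiplicity (int p)"
  have "int p ^ min (?m x) (?m y) dvd x + y"
    by (intro dvd_add multiplicity_dvd') auto
  hence "min (?m x) (?m y) \<le> ?m (x + y)"
    using nz p by (intro multiplicity_geI) (auto simp: prime_gt_Suc_0_nat dest: prime_gt_1_nat)
  hence "- padic_val p (a + b) \<le> - padic_val p a \<or> - padic_val p (a + b) \<le> - padic_val p b"
    unfolding ab' unfolding a' b' padic_val_divide[OF nz(1) d] padic_val_divide[OF nz(2) d]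
      padic_val_divide[OF nz(3) d] by linarith
  moreover have "real p \<ge> 1"
    using prime_gt_1_nat[OF p] by simp
  ultimately show ?thesis
    using False by (auto simp: padic_abs_def le_max_iff_disj intro: power_int_increasing)
qed (auto simp: le_max_iff_disj)

lemma padic_abs_diff: "padic_abs p (a - b) \<le> max (padic_abs p a) (padic_abs p b)"
  using padic_abs_add[of a "- b"] by simp

lemma padic_null_iff: "s \<in> padic_null p \<longleftrightarrow> (\<forall>e>0. \<exists>N. \<forall>i\<ge>N. padic_abs p (s i) < e)"
  by (simp add: padic_null_def LIMSEQ_iff)

lemma padic_Cauchy_const [simp]: "padic_Cauchy p (\<lambda>i. q)"
  by (simp add: padic_Cauchy_def)

lemma padic_Cauchy_add:
  assumes "padic_Cauchy p s" "padic_Cauchy p t"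
  shows "padic_Cauchy p (\<lambda>i. s i + t i)"
  unfolding padic_Cauchy_def
proof (intro allI impI)
  fix e :: real assume "e > 0"
  with assms obtain M N where M: "\<forall>i\<ge>M. \<forall>j\<ge>M. padic_abs p (s i - s j) < e"
    and N: "\<forall>i\<ge>N. \<forall>j\<ge>N. padic_abs p (t i - t j) < e"
    unfolding padic_Cauchy_def by blast
  have "padic_abs p (s i + t i - (s j + t j)) < e" if "i \<ge> max M N" "j \<ge> max M N" for i j
    using padic_abs_add[of "s i - s j" "t i - t j"] M N that
    by (auto simp: algebra_simps intro: le_less_trans)
  thus "\<exists>N. \<forall>i\<ge>N. \<forall>j\<ge>N. padic_abs p (s i + t i - (s j + t j)) < e"
    by blast
qed

lemma padic_Cauchy_bounded:
  assumes "padic_Cauchy p s"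
  shows "\<exists>B>0. \<forall>i. padic_abs p (s i) \<le> B"
proof -
  obtain N where N: "\<forall>i\<ge>N. \<forall>j\<ge>N. padic_abs p (s i - s j) < 1"
    using assms unfolding padic_Cauchy_def by (meson zero_less_one)
  define B where "B = 1 + (\<Sum>i\<le>N. padic_abs p (s i))"
  have le: "padic_abs p (s i) \<le> B" if "i \<le> N" for i
    using member_le_sum[of i "{..N}" "\<lambda>i. padic_abs p (s i)"] that by (simp add: B_def)
  have pos: "B \<ge> 1"
    by (simp add: B_def sum_nonneg)
  have "padic_abs p (s i) \<le> B" for i
  proof (cases "i \<le> N")
    case False
    have "padic_abs p (s i) \<le> max (padic_abs p (s i - s N)) (padic_abs p (s N))"
      using padic_abs_add[of "s i - s N" "s N"] by simp
    also have "\<dots> \<le> B"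
    proof -
      have "padic_abs p (s i - s N) < 1"
        using N False by simp
      thus ?thesis
        using le[of N] pos by simp
    qed
    finally show ?thesis .
  qed (use le in auto)
  thus ?thesis
    using pos by (intro exI[of _ B]) simp
qed

lemma padic_Cauchy_mult:
  assumes s: "padic_Cauchy p s" and t: "padic_Cauchy p t"
  shows "padic_Cauchy p (\<lambda>i. s i * t i)"
  unfolding padic_Cauchy_def
proof (intro allI impI)
  fix e :: real assume e: "e > 0"
  obtain B where B: "B > 0" "\<forall>i. padic_abs p (s i) \<le> B"
    using padic_Cauchy_bounded[OF s] by blast
  obtain C where C: "C > 0" "\<forall>i. padic_abs p (t i) \<le> C"
    using padic_Cauchy_bounded[OF t] by blast
  obtain M where M: "\<forall>i\<ge>M. \<forall>j\<ge>M. padic_abs p (s i - s j) < e / C"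
    using s e C unfolding padic_Cauchy_def by (meson divide_pos_pos)
  obtain N where N: "\<forall>i\<ge>N. \<forall>j\<ge>N. padic_abs p (t i - t j) < e / B"
    using t e B unfolding padic_Cauchy_def by (meson divide_pos_pos)
  have "padic_abs p (s i * t i - s j * t j) < e" if "i \<ge> max M N" "j \<ge> max M N" for i j
  proof -
    have "padic_abs p (s i * t i - s j * t j) = padic_abs p ((s i - s j) * t i + s j * (t i - t j))"
      by (simp add: algebra_simps)
    also have "\<dots> \<le> max (padic_abs p ((s i - s j) * t i)) (padic_abs p (s j * (t i - t j)))"
      by (rule padic_abs_add)
    also have "\<dots> < e"
    proof -
      have "padic_abs p (s i - s j) * padic_abs p (t i) \<le> padic_abs p (s i - s j) * C"
        using C by (simp add: mult_left_mono)
      also have "\<dots> < e"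
        using M that C by (simp add: field_simps)
      finally have 1: "padic_abs p (s i - s j) * padic_abs p (t i) < e" .
      have "padic_abs p (s j) * padic_abs p (t i - t j) \<le> B * padic_abs p (t i - t j)"
        using B by (simp add: mult_right_mono)
      also have "\<dots> < e"
        using N that B by (simp add: field_simps)
      finally show ?thesis
        using 1 by (simp add: padic_abs_mult)
    qed
    finally show ?thesis .
  qed
  thus "\<exists>N. \<forall>i\<ge>N. \<forall>j\<ge>N. padic_abs p (s i * t i - s j * t j) < e"
    by blast
qed

lemma padic_null_Cauchy:
  assumes "s \<in> padic_null p"
  shows "padic_Cauchy p s"
  unfolding padic_Cauchy_def
proof (intro allI impI)
  fix e :: real assume "e > 0"
  then obtain N where N: "\<forall>i\<ge>N. padic_abs p (s i) < e"
    using assms by (auto simp: padic_null_iff)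
  have "padic_abs p (s i - s j) < e" if "i \<ge> N" "j \<ge> N" for i j
    using padic_abs_diff[of "s i" "s j"] N that by (auto intro: le_less_trans)
  thus "\<exists>N. \<forall>i\<ge>N. \<forall>j\<ge>N. padic_abs p (s i - s j) < e"
    by blast
qed

lemma padic_null_add:
  assumes "s \<in> padic_null p" "t \<in> padic_null p"
  shows "(\<lambda>i. s i + t i) \<in> padic_null p"
  unfolding padic_null_iff
proof (intro allI impI)
  fix e :: real assume "e > 0"
  with assms obtain M N where "\<forall>i\<ge>M. padic_abs p (s i) < e" "\<forall>i\<ge>N. padic_abs p (t i) < e"
    unfolding padic_null_iff by blast
  hence "padic_abs p (s i + t i) < e" if "i \<ge> max M N" for i
    using padic_abs_add[of "s i" "t i"] that by (auto intro: le_less_trans)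
  thus "\<exists>N. \<forall>i\<ge>N. padic_abs p (s i + t i) < e"
    by blast
qed

lemma padic_null_mult:
  assumes "padic_Cauchy p s" "t \<in> padic_null p"
  shows "(\<lambda>i. s i * t i) \<in> padic_null p"
proof -
  obtain B where B: "B > 0" "\<forall>i. padic_abs p (s i) \<le> B"
    using padic_Cauchy_bounded[OF assms(1)] by blast
  have "(\<lambda>i. B * padic_abs p (t i)) \<longlonglongrightarrow> B * 0"
    using assms(2) unfolding padic_null_def by (intro tendsto_intros) simp
  hence lim: "(\<lambda>i. B * padic_abs p (t i)) \<longlonglongrightarrow> 0"
    by simp
  have "\<forall>i. padic_abs p (s i * t i) \<le> B * padic_abs p (t i)"
    using B by (simp add: padic_abs_mult mult_right_mono)
  hence "(\<lambda>i. padic_abs p (s i * t i)) \<longlonglongrightarrow> 0"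
    using lim by (intro tendsto_sandwich[OF _ _ tendsto_const lim]) simp_all
  thus ?thesis
    by (simp add: padic_null_def)
qed

lemma padic_Cauchy_inverse:
  assumes s: "padic_Cauchy p s" and nonnull: "s \<notin> padic_null p"
  obtains t where "padic_Cauchy p t" "(\<lambda>i. 1 - s i * t i) \<in> padic_null p"
proof -
  obtain e where e: "e > 0" "\<forall>N. \<exists>i\<ge>N. padic_abs p (s i) \<ge> e"
    using nonnull by (auto simp: padic_null_iff not_less)
  obtain N where N: "\<forall>i\<ge>N. \<forall>j\<ge>N. padic_abs p (s i - s j) < e"
    using s e unfolding padic_Cauchy_def by blast
  have ge: "padic_abs p (s i) \<ge> e" if i: "i \<ge> N" for i
  proof -
    obtain j where j: "j \<ge> N" "padic_abs p (s j) \<ge> e"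
      using e by blast
    have "padic_abs p (s j) \<le> max (padic_abs p (s j - s i)) (padic_abs p (s i))"
      using padic_abs_add[of "s j - s i" "s i"] by simp
    moreover have "padic_abs p (s j - s i) < e"
      using N i j by blast
    ultimately show ?thesis
      using j by linarith
  qed
  hence nz: "s i \<noteq> 0" if "i \<ge> N" for i
    using that e by force
  define t where "t = (\<lambda>i. inverse (s i))"
  have "padic_Cauchy p t"
    unfolding padic_Cauchy_def
  proof (intro allI impI)
    fix d :: real assume d: "d > 0"
    obtain M where M: "\<forall>i\<ge>M. \<forall>j\<ge>M. padic_abs p (s i - s j) < d * (e * e)"
      using s e d unfolding padic_Cauchy_def by (meson mult_pos_pos)
    have "padic_abs p (t i - t j) < d" if ij: "i \<ge> max M N" "j \<ge> max M N" for i j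
    proof -
      have "(t i - t j) * (s i * s j) = s j - s i"
        using nz ij by (simp add: t_def field_simps)
      hence "padic_abs p (t i - t j) * (padic_abs p (s i) * padic_abs p (s j)) < d * (e * e)"
        using M ij by (metis padic_abs_mult max.bounded_iff)
      moreover have "e * e \<le> padic_abs p (s i) * padic_abs p (s j)"
        using ge ij e by (intro mult_mono) auto
      hence "padic_abs p (t i - t j) * (e * e)
               \<le> padic_abs p (t i - t j) * (padic_abs p (s i) * padic_abs p (s j))"
        by (rule mult_left_mono) simp
      ultimately have "padic_abs p (t i - t j) * (e * e) < d * (e * e)"
        by linarith
      thus ?thesis
        using e by simp
    qed
    thus "\<exists>N. \<forall>i\<ge>N. \<forall>j\<ge>N. padic_abs p (t i - t j) < d"
      by blast
  qed
  moreover have "(\<lambda>i. 1 - s i * t i) \<in> padic_null p"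
    unfolding padic_null_iff using nz by (auto simp: t_def intro!: exI[of _ N])
  ultimately show thesis
    using that by blast
qed

lemma padic_Cauchy_ring_cring: "cring (padic_Cauchy_ring p)"
proof (intro cringI abelian_groupI comm_monoidI)
  fix s assume "s \<in> carrier (padic_Cauchy_ring p)"
  hence "padic_Cauchy p (\<lambda>i. - 1 * s i)"
    by (intro padic_Cauchy_mult) (auto simp: padic_Cauchy_ring_def)
  thus "\<exists>t\<in>carrier (padic_Cauchy_ring p). t \<oplus>\<^bsub>padic_Cauchy_ring p\<^esub> s = \<zero>\<^bsub>padic_Cauchy_ring p\<^esub>"
    by (intro bexI[of _ "\<lambda>i. - s i"]) (auto simp: padic_Cauchy_ring_def)
qed (auto simp: padic_Cauchy_ring_def padic_Cauchy_add padic_Cauchy_mult algebra_simps)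

lemma padic_null_ideal: "ideal (padic_null p) (padic_Cauchy_ring p)"
proof -
  interpret R: cring "padic_Cauchy_ring p"
    by (rule padic_Cauchy_ring_cring)
  have minus: "\<ominus>\<^bsub>padic_Cauchy_ring p\<^esub> s = (\<lambda>i. - s i)" if "s \<in> padic_null p" for s
  proof (rule R.minus_equality)
    show "s \<in> carrier (padic_Cauchy_ring p)"
      using that by (simp add: padic_Cauchy_ring_def padic_null_Cauchy)
    show "(\<lambda>i. - s i) \<in> carrier (padic_Cauchy_ring p)"
      using that by (auto simp: padic_Cauchy_ring_def padic_null_def intro!: padic_null_Cauchy)
  qed (auto simp: padic_Cauchy_ring_def)
  show ?thesis
  proof (rule idealI)
    show "ring (padic_Cauchy_ring p)" ..
    show "subgroup (padic_null p) (add_monoid (padic_Cauchy_ring p))"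
    proof (rule R.add.subgroupI)
      show "\<ominus>\<^bsub>padic_Cauchy_ring p\<^esub> s \<in> padic_null p" if "s \<in> padic_null p" for s
        using minus[OF that] that by (simp add: padic_null_def)
      show "padic_null p \<noteq> {}"
        by (auto simp: padic_null_def intro!: exI[of _ "\<lambda>i. 0"])
    qed (auto simp: padic_Cauchy_ring_def padic_null_Cauchy padic_null_add)
  next
    fix s t assume st: "s \<in> padic_null p" "t \<in> carrier (padic_Cauchy_ring p)"
    thus "t \<otimes>\<^bsub>padic_Cauchy_ring p\<^esub> s \<in> padic_null p"
      by (simp add: padic_Cauchy_ring_def padic_null_mult)
    have "(\<lambda>i. t i * s i) \<in> padic_null p"
      using st by (intro padic_null_mult) (auto simp: padic_Cauchy_ring_def)
    thus "s \<otimes>\<^bsub>padic_Cauchy_ring p\<^esub> t \<in> padic_null p"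
      by (simp add: padic_Cauchy_ring_def mult.commute)
  qed
qed

lemma padic_null_maximalideal: "maximalideal (padic_null p) (padic_Cauchy_ring p)"
proof (rule maximalidealI[OF padic_null_ideal])
  have "(\<lambda>i. 1) \<notin> padic_null p"
    by (simp add: padic_null_def LIMSEQ_const_iff)
  moreover have "(\<lambda>i. 1) \<in> carrier (padic_Cauchy_ring p)"
    by (simp add: padic_Cauchy_ring_def)
  ultimately show "carrier (padic_Cauchy_ring p) \<noteq> padic_null p"
    by metis
next
  fix J assume J: "ideal J (padic_Cauchy_ring p)" "padic_null p \<subseteq> J"
    "J \<subseteq> carrier (padic_Cauchy_ring p)"
  interpret J: ideal J "padic_Cauchy_ring p"
    by (rule J)
  show "J = padic_null p \<or> J = carrier (padic_Cauchy_ring p)"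
  proof (cases "J = padic_null p")
    case False
    then obtain s where s: "s \<in> J" "s \<notin> padic_null p"
      using J by blast
    moreover have "padic_Cauchy p s"
      using s J by (auto simp: padic_Cauchy_ring_def)
    ultimately obtain t where t: "padic_Cauchy p t" "(\<lambda>i. 1 - s i * t i) \<in> padic_null p"
      using padic_Cauchy_inverse by blast
    have "s \<otimes>\<^bsub>padic_Cauchy_ring p\<^esub> t \<in> J"
      using s t by (intro J.I_r_closed) (auto simp: padic_Cauchy_ring_def)
    hence "(s \<otimes>\<^bsub>padic_Cauchy_ring p\<^esub> t) \<oplus>\<^bsub>padic_Cauchy_ring p\<^esub> (\<lambda>i. 1 - s i * t i) \<in> J"
      using t J by (simp add: subset_iff additive_subgroup.a_closed[OF ideal.axioms(1)[OF J(1)]])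
    hence "\<one>\<^bsub>padic_Cauchy_ring p\<^esub> \<in> J"
      by (simp add: padic_Cauchy_ring_def)
    thus ?thesis
      using J.one_imp_carrier by simp
  qed auto
qed

theorem padic_field_field: "field (padic_field p)"
  unfolding padic_field_def
  using padic_null_maximalideal padic_Cauchy_ring_cring by (rule maximalideal.quotient_is_field)

end

end

theory Submission
  imports Defs
    "HOL-Analysis.Determinants"
    "HOL-Library.Discrete_Functions"
    "HOL-Number_Theory.Euler_Criterion"
begin

text \<open>
  Up to squares both forms are multiples of the norm form of $\mathbb{Q}(i)$, so they are similar iff
  $n/m$ is a sum of two rational squares, that is, iff $v_p(n)$ and $v_p(m)$ have the same parity for
  every prime $p$ with $p$ mod 4 = 3. On the other side, for odd $p$ the symbol $(n, nx^2)_p$ is 1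
  unless $p$ mod 4 = 3 and $v_p(n)$ is odd. Solutions come from Hensel's lemma for square roots. In
  the exceptional case there are none: $|a^2 + b^2|_p = \max(|a|_p, |b|_p)^2$, hence
  $n(a^2 + b^2)$ and $c^2$ have valuations of different parity.
\<close>

section \<open>Sums of two squares\<close>

text \<open>Euler's criterion equates the Legendre symbol of -1 with (-1)^((p - 1) div 2) modulo p.
  As p > 2, the values -1, 0 and 1 are distinct modulo p, so the parity of the exponent
  decides.\<close>

lemma QuadRes_minus_one_iff:
  fixes p :: nat
  assumes "prime p" "odd p"
  shows "QuadRes (int p) (- 1) \<longleftrightarrow> p mod 4 = 1"
proof -
  have p2: "2 < p"
    using assms prime_gt_1_nat[of p] by (cases "p = 2") auto
  have ndvd: "\<not> [-1 = 0] (mod int p)" "\<not> [-1 = 1] (mod int p)" 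
    using p2 zdvd_imp_le[of "int p" 2] by (auto simp: cong_iff_dvd_diff)
  have "[Legendre (- 1) (int p) = (- 1) ^ ((p - 1) div 2)] (mod int p)"
    using assms(1) p2 by (rule euler_criterion)
  moreover have "p mod 4 = 1 \<or> p mod 4 = 3"
    using assms(2) by presburger
  moreover have "even ((p - 1) div 2)" if "p mod 4 = 1"
    using that by presburger
  moreover have "odd ((p - 1) div 2)" if "p mod 4 = 3"
    using that by presburger
  ultimately show ?thesis
    using ndvd by (auto simp: Legendre_def cong_sym_eq split: if_splits)
qed

text \<open>Otherwise b is invertible modulo p, and dividing by b^2 would produce a square root of
  -1, which does not exist for p mod 4 = 3.\<close>

lemma prime_dvd_sum_squares_imp_dvd:
  fixes p :: nat and a b :: int
  assumes p: "prime p" "p mod 4 = 3" and dvd: "int p dvd a\<^sup>2 + b\<^sup>2"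
  shows "int p dvd b"
proof (rule ccontr)
  assume "\<not> int p dvd b"
  hence "coprime b (int p)"
    using p(1) by (metis coprime_commute prime_imp_coprime prime_nat_int_transfer)
  then obtain c where c: "[b * c = 1] (mod int p)"
    using cong_solve_coprime_int by blast
  have "[a\<^sup>2 * c\<^sup>2 + b\<^sup>2 * c\<^sup>2 = 0] (mod int p)"
    using dvd by (metis cong_0_iff dvd_mult2 distrib_right)
  moreover have "[b\<^sup>2 * c\<^sup>2 = 1] (mod int p)"
    using cong_pow[OF c, of 2] by (simp add: power_mult_distrib)
  ultimately have "[(a * c)\<^sup>2 + 1 = 0] (mod int p)"
    by (metis cong_add_lcancel cong_sym cong_trans power_mult_distrib)
  hence "QuadRes (int p) (- 1)"
    by (auto simp: QuadRes_def cong_iff_dvd_diff)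
  moreover have "odd p"
    using p(2) by presburger
  ultimately show False
    using QuadRes_minus_one_iff p by simp
qed

text \<open>The norm of Gaussian integers is multiplicative.\<close>

lemma sum_two_squares_mult:
  fixes M N :: nat
  assumes "M = a\<^sup>2 + b\<^sup>2" "N = c\<^sup>2 + d\<^sup>2"
  shows "\<exists>e f. M * N = e\<^sup>2 + f\<^sup>2"
proof -
  \<comment> \<open>The difference a c - b d may be negative, so the identity is checked over the
    integers.\<close>
  have "int (M * N) = (int a * int c - int b * int d)\<^sup>2 + (int a * int d + int b * int c)\<^sup>2"
    by (simp add: assms algebra_simps power2_eq_square)
  also have "\<dots> = int ((nat \<bar>int a * int c - int b * int d\<bar>)\<^sup>2 + (nat \<bar>int a * int d + int b * int c\<bar>)\<^sup>2)"
    by simp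
  finally have "M * N = (nat \<bar>int a * int c - int b * int d\<bar>)\<^sup>2 + (nat \<bar>int a * int d + int b * int c\<bar>)\<^sup>2"
    by (simp only: of_nat_eq_iff)
  thus ?thesis
    by blast
qed

text \<open>Thue's pigeonhole argument on the pairs $(i, j)$ with $0 \leq i, j \leq \lfloor\sqrt p\rfloor$.\<close>
lemma prime_sum_two_squares:
  fixes p :: nat
  assumes p: "prime p" "p mod 4 = 1"
  shows "\<exists>a b. p = a\<^sup>2 + b\<^sup>2"
proof -
  have "odd p"
    using p(2) by presburger
  then obtain s :: int where s: "[s\<^sup>2 = -1] (mod int p)"
    using QuadRes_minus_one_iff p unfolding QuadRes_def by blast
  define k where "k = floor_sqrt p"
  have k: "k\<^sup>2 \<le> p" "p < (Suc k)\<^sup>2"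
    by (simp_all add: k_def Suc_floor_sqrt_power2_gt)
  \<comment> \<open>A prime is not a square. The strict bound k^2 < p yields a^2 + b^2 < 2 p, which
    later forces the cofactor q to be 1.\<close>
  have "k\<^sup>2 \<noteq> p"
    using p(1) by (metis prime_power_iff zero_neq_numeral numeral_eq_one_iff semiring_norm(85))
  with k have kp: "k\<^sup>2 < p"
    by simp
  define S where "S = {0..int k} \<times> {0..int k}"
  define f where "f = (\<lambda>(i, j). (s * i - j) mod int p)"
  have "card S = (Suc k)\<^sup>2"
    by (simp add: S_def power2_eq_square nat_add_distrib)
  have p0: "int p > 0"
    using prime_gt_0_nat[OF p(1)] by simp
  hence "f ` S \<subseteq> {0..<int p}"
    by (auto simp: f_def)
  hence "card (f ` S) \<le> p"
    using card_mono[of "{0..<int p}" "f ` S"] by simp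
  hence "\<not> inj_on f S"
    using \<open>card S = _\<close> k by (metis card_image not_le)
  then obtain i j i' j' where ij: "(i, j) \<in> S" "(i', j') \<in> S" "(i, j) \<noteq> (i', j')"
    "f (i, j) = f (i', j')"
    unfolding inj_on_def by fast
  define a b where "a = i - i'" and "b = j - j'"
  have "\<bar>a\<bar> \<le> int k" "\<bar>b\<bar> \<le> int k"
    using ij by (auto simp: S_def a_def b_def)
  hence "a\<^sup>2 \<le> (int k)\<^sup>2" "b\<^sup>2 \<le> (int k)\<^sup>2"
    by (metis abs_ge_zero power2_abs power_mono)+
  moreover have "(int k)\<^sup>2 < int p"
    using kp by (metis of_nat_less_iff of_nat_power)
  ultimately have lt: "a\<^sup>2 + b\<^sup>2 < 2 * int p"
    by linarith
  have "a \<noteq> 0 \<or> b \<noteq> 0"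
    using ij(3) by (auto simp: a_def b_def)
  hence pos: "a\<^sup>2 + b\<^sup>2 > 0"
    by (simp add: sum_power2_gt_zero_iff)
  have "int p dvd (s * i - j) - (s * i' - j')"
    using ij(4) by (simp add: f_def mod_eq_dvd_iff)
  hence "int p dvd s * a - b"
    by (simp add: a_def b_def algebra_simps)
  \<comment> \<open>Modulo p, b equals s a and s^2 equals -1, so a^2 + b^2 vanishes; the next steps
    express this as a divisibility.\<close>
  hence "int p dvd (s * a - b) * (s * a + b)"
    by simp
  moreover have "int p dvd (s\<^sup>2 + 1) * a\<^sup>2"
    using s by (simp add: cong_iff_dvd_diff)
  ultimately have "int p dvd (s\<^sup>2 + 1) * a\<^sup>2 - (s * a - b) * (s * a + b)"
    by (rule dvd_diff[rotated])
  also have "(s\<^sup>2 + 1) * a\<^sup>2 - (s * a - b) * (s * a + b) = a\<^sup>2 + b\<^sup>2"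
    by (simp add: algebra_simps power2_eq_square)
  finally obtain q where q: "a\<^sup>2 + b\<^sup>2 = int p * q"
    by (elim dvdE)
  have "q > 0"
    using pos p0 q by (metis zero_less_mult_pos)
  moreover have "q < 2"
    using lt p0 q by (simp add: mult.commute)
  ultimately have "int p = a\<^sup>2 + b\<^sup>2"
    using q by simp
  also have "\<dots> = int ((nat \<bar>a\<bar>)\<^sup>2 + (nat \<bar>b\<bar>)\<^sup>2)"
    by simp
  finally have "p = (nat \<bar>a\<bar>)\<^sup>2 + (nat \<bar>b\<bar>)\<^sup>2"
    by (simp only: of_nat_eq_iff)
  thus ?thesis
    by blast
qed

text \<open>Strong induction, splitting off a prime factor p. If p mod 4 = 3, its exponent is at
  least 2 and p^2 is absorbed by scaling a and b; otherwise p is itself a sum of two squares and the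
  product identity applies. Either way the parities of the relevant exponents survive.\<close>

lemma sum_two_squares_if_even_multiplicity:
  fixes N :: nat
  assumes "N > 0" "\<And>p. prime p \<Longrightarrow> p mod 4 = 3 \<Longrightarrow> even (multiplicity p N)"
  shows "\<exists>a b. N = a\<^sup>2 + b\<^sup>2"
  using assms
proof (induction N rule: less_induct)
  case (less N)
  show ?case
  proof (cases "N = 1")
    case True
    thus ?thesis
      by (intro exI[of _ 1] exI[of _ 0]) simp
  next
    case False
    then obtain p where p: "prime p" "p dvd N"
      using prime_factor_nat by blast
    show ?thesis
    proof (cases "p mod 4 = 3")
      case True
      have "multiplicity p N \<noteq> 0"
        using p less.prems(1) by (simp add: prime_multiplicity_gt_zero_iff)
      hence "2 \<le> multiplicity p N"
        using less.prems(2)[OF p(1) True] by presburger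
      hence "p\<^sup>2 dvd N"
        by (rule multiplicity_dvd')
      then obtain M where M: "N = p\<^sup>2 * M"
        by (elim dvdE)
      have M0: "M > 0"
        using M less.prems(1) by simp
      have "p\<^sup>2 > 1"
        using prime_gt_1_nat[OF p(1)] by (rule one_less_power) simp
      hence "M < N"
        using M M0 by simp
      moreover have "even (multiplicity q M)" if q: "prime q" "q mod 4 = 3" for q
      proof -
        \<comment> \<open>This form covers both q = p and q \<noteq> p: the exponent changes by an
          even number.\<close>
        have "multiplicity q N = 2 * multiplicity q p + multiplicity q M"
          using M M0 p q
          by (simp add: prime_elem_multiplicity_mult_distrib prime_elem_multiplicity_power_distrib
              prime_gt_0_nat)
        thus ?thesis
          using less.prems(2)[OF q] by simp
      qed
      ultimately obtain a b where "M = a\<^sup>2 + b\<^sup>2"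
        using less.IH M0 by blast
      hence "N = (p * a)\<^sup>2 + (p * b)\<^sup>2"
        by (simp add: M power_mult_distrib algebra_simps)
      thus ?thesis
        by blast
    next
      case False
      obtain M where M: "N = p * M"
        using p(2) by (elim dvdE)
      have M0: "M > 0"
        using M less.prems(1) by simp
      have "M < N"
        using M M0 prime_gt_1_nat[OF p(1)] by simp
      moreover have "even (multiplicity q M)" if q: "prime q" "q mod 4 = 3" for q
      proof -
        have "multiplicity q p = 0"
          using p q False by (intro prime_multiplicity_other) auto
        hence "multiplicity q N = multiplicity q M"
          using M M0 p q by (simp add: prime_elem_multiplicity_mult_distrib prime_gt_0_nat)
        thus ?thesis
          using less.prems(2)[OF q] by simp
      qed
      ultimately obtain a b where "M = a\<^sup>2 + b\<^sup>2"
        using less.IH M0 by blast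
      moreover have "\<exists>c d. p = c\<^sup>2 + d\<^sup>2"
      proof (cases "p = 2")
        case True
        thus ?thesis
          by (intro exI[of _ 1]) simp
      next
        case False
        hence "odd p"
          using p(1) prime_odd_nat prime_ge_2_nat[of p] by force
        hence "p mod 4 = 1"
          using \<open>p mod 4 \<noteq> 3\<close> by presburger
        thus ?thesis
          using prime_sum_two_squares p(1) by blast
      qed
      ultimately show ?thesis
        using sum_two_squares_mult M by blast
    qed
  qed
qed

section \<open>Quadratic residues and lifting of square roots\<close>

lemma not_dvd_if_square_cong:
  fixes a c m :: int
  assumes "[a\<^sup>2 = c] (mod m)" "\<not> m dvd c"
  shows "\<not> m dvd a"
proof
  assume "m dvd a"
  hence "m dvd a\<^sup>2"
    by (simp add: power2_eq_square)
  with assms show False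
    by (simp add: cong_dvd_iff)
qed

text \<open>For a nonresidue u it suffices to find a nonresidue 1 + r^2, since the product of two
  nonresidues is a residue. If there were none, the squares modulo p would be closed under adding 1,
  so every integer would be a square modulo p, including u.\<close>

lemma ex_quadratic_residue_times_one_plus_square:
  fixes p :: nat and u :: int
  assumes p: "prime p" "odd p" and u: "\<not> int p dvd u"
  shows "\<exists>r a. [a\<^sup>2 = u * (1 + r\<^sup>2)] (mod int p) \<and> \<not> int p dvd a"
proof -
  have p2: "2 < p"
    using p prime_gt_1_nat[of p] by (cases "p = 2") auto
  have pp: "prime (int p)"
    using p by simp
  have euler: "[Legendre c (int p) = c ^ ((p - 1) div 2)] (mod int p)" for c
    using p(1) p2 by (rule euler_criterion)
  show ?thesis
  proof (cases "QuadRes (int p) u")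
    case True
    then obtain a where a: "[a\<^sup>2 = u] (mod int p)"
      unfolding QuadRes_def by blast
    moreover have "\<not> int p dvd a"
      using a u by (rule not_dvd_if_square_cong)
    ultimately show ?thesis
      by (intro exI[of _ 0] exI[of _ a]) simp
  next
    case nonres: False
    have "\<exists>r. \<not> QuadRes (int p) (1 + r\<^sup>2)"
    proof (rule ccontr)
      assume all: "\<nexists>r. \<not> QuadRes (int p) (1 + r\<^sup>2)"
      have "QuadRes (int p) (int k)" for k
      proof (induction k)
        case 0
        show ?case
          unfolding QuadRes_def by (intro exI[of _ 0]) simp
      next
        case (Suc k)
        then obtain y where y: "[y\<^sup>2 = int k] (mod int p)"
          unfolding QuadRes_def by blast
        obtain z where z: "[z\<^sup>2 = 1 + y\<^sup>2] (mod int p)"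
          using all unfolding QuadRes_def by blast
        have "[z\<^sup>2 = int (Suc k)] (mod int p)"
          using cong_trans[OF z cong_add[OF cong_refl y]] by simp
        thus ?case
          unfolding QuadRes_def by blast
      qed
      from this[of "nat (u mod int p)"] have "QuadRes (int p) (u mod int p)"
        using p2 by simp
      hence "QuadRes (int p) u"
        by (simp add: QuadRes_def)
      with nonres show False
        by simp
    qed
    then obtain r where r: "\<not> QuadRes (int p) (1 + r\<^sup>2)"
      by blast
    \<comment> \<open>\<open>QuadRes\<close> counts 0 as a square, so a nonresidue is prime to p and
      has Legendre symbol -1.\<close>
    have r0: "\<not> int p dvd 1 + r\<^sup>2"
    proof
      assume "int p dvd 1 + r\<^sup>2"
      hence "[0\<^sup>2 = 1 + r\<^sup>2] (mod int p)"
        by (simp add: cong_0_iff cong_sym)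
      with r show False
        unfolding QuadRes_def by blast
    qed
    let ?c = "u * (1 + r\<^sup>2)"
    have c0: "\<not> int p dvd ?c"
      using pp u r0 by (simp add: prime_dvd_mult_iff)
    have "Legendre u (int p) = - 1" "Legendre (1 + r\<^sup>2) (int p) = - 1"
      using u nonres r0 r by (simp_all add: Legendre_def cong_0_iff)
    hence "[u ^ ((p - 1) div 2) * (1 + r\<^sup>2) ^ ((p - 1) div 2) = (- 1) * (- 1)] (mod int p)"
      using cong_mult[OF cong_sym[OF euler[of u]] cong_sym[OF euler[of "1 + r\<^sup>2"]]] by simp
    hence "[Legendre ?c (int p) = 1] (mod int p)"
      using cong_trans[OF euler[of ?c]] by (simp add: power_mult_distrib)
    moreover have "\<not> [- 1 = 1] (mod int p)"
      using p2 zdvd_imp_le[of "int p" 2] by (auto simp: cong_iff_dvd_diff)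
    ultimately have "QuadRes (int p) ?c"
      using c0 by (auto simp: Legendre_def cong_0_iff split: if_splits)
    then obtain a where a: "[a\<^sup>2 = ?c] (mod int p)"
      unfolding QuadRes_def by blast
    moreover have "\<not> int p dvd a"
      using a c0 by (rule not_dvd_if_square_cong)
    ultimately show ?thesis
      by blast
  qed
qed

section \<open>Hensel lifting of square roots\<close>

text \<open>One step of Newton's method for X^2 - c. Since p is odd and does not divide s, the
  derivative 2 s is invertible modulo p; nondivisibility passes to t, so the step can be
  repeated.\<close>

lemma Hensel_square_step:
  fixes p :: nat and s c :: int
  assumes p: "prime p" "odd p" and s: "[s\<^sup>2 = c] (mod int p ^ Suc k)" "\<not> int p dvd s"
  shows "\<exists>t. [t\<^sup>2 = c] (mod int p ^ Suc (Suc k)) \<and> \<not> int p dvd t \<and> [t = s] (mod int p ^ Suc k)"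
proof -
  obtain e where e: "c - s\<^sup>2 = int p ^ Suc k * e"
    using s(1) by (metis cong_iff_dvd_diff cong_sym dvdE)
  have pp: "prime (int p)"
    using p by simp
  have "\<not> int p dvd 2"
    using p zdvd_imp_le[of "int p" 2] prime_ge_2_nat[of p] by (cases "p = 2") auto
  hence "\<not> int p dvd 2 * s"
    using pp s(2) by (simp add: prime_dvd_mult_iff)
  hence "coprime (2 * s) (int p)"
    using pp by (metis coprime_commute prime_imp_coprime)
  then obtain v where v: "[2 * s * v = 1] (mod int p)"
    using cong_solve_coprime_int by blast
  \<comment> \<open>With c - s^2 = p^(k+1) e and v an inverse of 2 s modulo p, the correction
    p^(k+1) e v cancels the error modulo p^(k+2).\<close>
  define t where "t = s + int p ^ Suc k * (e * v)"
  have "t\<^sup>2 - c = int p ^ Suc k * (e * (2 * s * v - 1) + int p ^ Suc k * (e * v)\<^sup>2)"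
    using e by (simp add: t_def algebra_simps power2_eq_square)
  moreover have "int p dvd e * (2 * s * v - 1) + int p ^ Suc k * (e * v)\<^sup>2"
    using v by (intro dvd_add dvd_mult[of _ _ e] dvd_mult2[of _ "int p ^ Suc k"])
      (simp_all add: cong_iff_dvd_diff)
  ultimately have "int p ^ Suc k * int p dvd t\<^sup>2 - c"
    by (metis mult_dvd_mono dvd_refl)
  hence "[t\<^sup>2 = c] (mod int p ^ Suc (Suc k))"
    by (simp add: cong_iff_dvd_diff mult.commute)
  moreover have ts: "[t = s] (mod int p ^ Suc k)"
    by (simp add: t_def cong_iff_dvd_diff)
  moreover have "\<not> int p dvd t"
  proof -
    have "[t = s] (mod int p)"
      using ts by (rule cong_dvd_modulus) simp
    thus ?thesis
      using s(2) cong_dvd_iff by blast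
  qed
  ultimately show ?thesis
    by blast
qed

lemma Hensel_square_sequence:
  fixes p :: nat and a c :: int
  assumes p: "prime p" "odd p" and a: "[a\<^sup>2 = c] (mod int p)" "\<not> int p dvd a"
  obtains f :: "nat \<Rightarrow> int" where
    "\<And>k. [(f k)\<^sup>2 = c] (mod int p ^ k)" "\<And>k. [f (Suc k) = f k] (mod int p ^ k)"
proof -
  have "\<exists>f. \<forall>k. ([(f k)\<^sup>2 = c] (mod int p ^ Suc k) \<and> \<not> int p dvd f k) \<and>
          [f (Suc k) = f k] (mod int p ^ Suc k)"
    using a Hensel_square_step[OF p] by (intro dependent_nat_choice) auto
  then obtain f where f: "\<And>k. [(f k)\<^sup>2 = c] (mod int p ^ Suc k)"
    "\<And>k. [f (Suc k) = f k] (mod int p ^ Suc k)"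
    by blast
  \<comment> \<open>The choice starts from a root modulo p, so \<open>f k\<close> is a root modulo
    p^(k+1); the exponents are lowered by one to k.\<close>
  have "int p ^ k dvd int p ^ Suc k" for k
    by simp
  with f show thesis
    by (metis that cong_dvd_modulus)
qed

section \<open>The $p$-adic absolute value and the equation of the Hilbert symbol\<close>

lemma padic_abs_of_int_le:
  assumes p: "prime p" and dvd: "int p ^ k dvd z"
  shows "padic_abs p (of_int z) \<le> (1 / real p) ^ k"
proof (cases "z = 0")
  case False
  have "k \<le> multiplicity (int p) z"
    using False p dvd by (intro multiplicity_geI) (auto dest: prime_gt_1_nat)
  moreover have "padic_val p (of_int z) = int (multiplicity (int p) z)"
    using padic_val_divide[OF p False, of 1] by simp
  ultimately have "padic_abs p (of_int z) \<le> real p powi (- int k)"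
    using False prime_gt_1_nat[OF p] by (auto simp: padic_abs_def intro!: power_int_increasing)
  thus ?thesis
    by (simp add: power_int_minus power_one_over field_simps)
qed simp

lemma inverse_power_tendsto_zero:
  assumes "prime p"
  shows "(\<lambda>k. (1 / real p) ^ k) \<longlonglongrightarrow> 0"
  using prime_gt_1_nat[OF assms] by (intro LIMSEQ_power_zero) auto

lemma padic_null_of_int:
  assumes p: "prime p" and dvd: "\<And>k. int p ^ k dvd f k"
  shows "(\<lambda>k. of_int (f k)) \<in> padic_null p"
proof -
  have "(\<lambda>k. padic_abs p (of_int (f k))) \<longlonglongrightarrow> 0"
    using padic_abs_of_int_le[OF p dvd]
    by (intro tendsto_sandwich[OF _ _ tendsto_const inverse_power_tendsto_zero[OF p]]) auto
  thus ?thesis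
    by (simp add: padic_null_def)
qed

lemma padic_Cauchy_of_int:
  assumes p: "prime p" and step: "\<And>k. [f (Suc k) = f k] (mod int p ^ k)"
  shows "padic_Cauchy p (\<lambda>k. of_int (f k))"
  unfolding padic_Cauchy_def
proof (intro allI impI)
  fix e :: real assume "e > 0"
  then obtain N where "\<forall>k\<ge>N. norm ((1 / real p) ^ k - 0) < e"
    using inverse_power_tendsto_zero[OF p] unfolding LIMSEQ_iff by blast
  hence N: "(1 / real p) ^ N < e"
    by auto
  \<comment> \<open>Chaining the congruences of consecutive terms makes all later terms agree modulo
    p^N, so their differences are at most p^(-N) < e.\<close>
  have cong: "[f i = f N] (mod int p ^ N)" if "i \<ge> N" for i
    using that
  proof (induction i rule: dec_induct)
    case (step i)
    have "[f (Suc i) = f i] (mod int p ^ N)"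
      using assms(2)[of i] by (rule cong_dvd_modulus) (use step in \<open>simp add: le_imp_power_dvd\<close>)
    with step.IH show ?case
      using cong_trans by blast
  qed simp
  have "padic_abs p (of_int (f i) - of_int (f j)) < e" if "i \<ge> N" "j \<ge> N" for i j
  proof -
    have "int p ^ N dvd f i - f j"
      using cong[OF that(1)] cong[OF that(2)] by (meson cong_iff_dvd_diff cong_sym cong_trans)
    from padic_abs_of_int_le[OF p this] N show ?thesis
      by simp
  qed
  thus "\<exists>N. \<forall>i\<ge>N. \<forall>j\<ge>N. padic_abs p (of_int (f i) - of_int (f j)) < e"
    by blast
qed

text \<open>The approximations from Hensel lifting, viewed as rationals, form a Cauchy sequence
  whose squares tend to c; it represents a square root of c in the p-adic field.\<close>

lemma padic_sqrt_exists:
  fixes p :: nat and a c :: int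
  assumes p: "prime p" "odd p" and a: "[a\<^sup>2 = c] (mod int p)" "\<not> int p dvd a"
  obtains s where "padic_Cauchy p s" "(\<lambda>i. (s i)\<^sup>2 - of_int c) \<in> padic_null p"
proof -
  obtain f :: "nat \<Rightarrow> int" where f: "\<And>k. [(f k)\<^sup>2 = c] (mod int p ^ k)"
    "\<And>k. [f (Suc k) = f k] (mod int p ^ k)"
    using Hensel_square_sequence[OF assms] by blast
  have "(\<lambda>k. of_int ((f k)\<^sup>2 - c)) \<in> padic_null p"
    using f by (intro padic_null_of_int[OF p(1)]) (simp add: cong_iff_dvd_diff)
  with padic_Cauchy_of_int[OF p(1) f(2)] show thesis
    by (intro that[of "\<lambda>k. of_int (f k)"]) simp_all
qed

section \<open>The Hilbert symbol in terms of Cauchy sequences\<close>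

text \<open>Unfolds the quotient ring once and for all: the projection \<open>h\<close> is a
  surjective ring homomorphism whose kernel is the ideal of null sequences, so an equation between
  cosets says that a rational sequence is null.\<close>

lemma Hilbert_symbol_eq_1_iff:
  assumes p: "prime p"
  shows "Hilbert_symbol a b p = 1 \<longleftrightarrow>
    (\<exists>s t u. padic_Cauchy p s \<and> padic_Cauchy p t \<and> padic_Cauchy p u \<and>
       \<not> (s \<in> padic_null p \<and> t \<in> padic_null p \<and> u \<in> padic_null p) \<and>
       (\<lambda>i. a * (s i)\<^sup>2 + b * (t i)\<^sup>2 - (u i)\<^sup>2) \<in> padic_null p)"
proof -
  let ?R = "padic_Cauchy_ring p" and ?I = "padic_null p"
  interpret R: cring ?R
    using p by (rule padic_Cauchy_ring_cring)
  interpret I: ideal ?I ?R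
    using p by (rule padic_null_ideal)
  let ?K = "?R Quot ?I"
  define h where "h = (\<lambda>s. ?I +>\<^bsub>?R\<^esub> s)"
  interpret h: ring_hom_ring ?R ?K h
    unfolding h_def by (rule I.rcos_ring_hom_ring)
  have carr: "s \<in> carrier ?R \<longleftrightarrow> padic_Cauchy p s" for s
    by (simp add: padic_Cauchy_ring_def)
  have carrK: "carrier ?K = h ` Collect (padic_Cauchy p)"
    by (auto simp: FactRing_def A_RCOSETS_def' h_def carr)
  have mult: "s \<otimes>\<^bsub>?R\<^esub> t = (\<lambda>i. s i * t i)" and add: "s \<oplus>\<^bsub>?R\<^esub> t = (\<lambda>i. s i + t i)"
    and one: "\<one>\<^bsub>?R\<^esub> = (\<lambda>i. 1)" for s t
    by (simp_all add: padic_Cauchy_ring_def)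
  have sq: "s [^]\<^bsub>?R\<^esub> (2::nat) = (\<lambda>i. (s i)\<^sup>2)" if "padic_Cauchy p s" for s
    by (simp add: numeral_2_eq_2 mult one power2_eq_square)
  have minus: "s \<ominus>\<^bsub>?R\<^esub> t = (\<lambda>i. s i - t i)" if "padic_Cauchy p s" "padic_Cauchy p t" for s t
  proof -
    have "padic_Cauchy p (\<lambda>i. - 1 * t i)"
      using p that by (intro padic_Cauchy_mult) simp_all
    hence "\<ominus>\<^bsub>?R\<^esub> t = (\<lambda>i. - t i)"
      using that by (intro R.minus_equality) (simp_all add: padic_Cauchy_ring_def)
    thus ?thesis
      by (simp add: a_minus_def add)
  qed
  have eq: "h s = h t \<longleftrightarrow> (\<lambda>i. s i - t i) \<in> ?I" if "padic_Cauchy p s" "padic_Cauchy p t" for s t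
    using that R.quotient_eq_iff_same_a_r_cos[OF I.is_ideal, of s t] carr
    by (simp only: h_def minus[OF that, symmetric])
  have zero: "h s = \<zero>\<^bsub>?K\<^esub> \<longleftrightarrow> s \<in> ?I" if "padic_Cauchy p s" for s
  proof -
    have "\<zero>\<^bsub>?R\<^esub> = (\<lambda>i. 0)"
      by (simp add: padic_Cauchy_ring_def)
    thus ?thesis
      using eq[OF that padic_Cauchy_const[OF p, of 0]] h.hom_zero by simp
  qed
  have C: "padic_Cauchy p (\<lambda>i. q * (s i)\<^sup>2)" "padic_Cauchy p (\<lambda>i. (s i)\<^sup>2)"
    if "padic_Cauchy p s" for s q
    using p that by (auto simp: power2_eq_square intro!: padic_Cauchy_mult)
  have equation: "(h (\<lambda>i. a) \<otimes>\<^bsub>?K\<^esub> h s [^]\<^bsub>?K\<^esub> (2::nat)) \<oplus>\<^bsub>?K\<^esub> (h (\<lambda>i. b) \<otimes>\<^bsub>?K\<^esub> h t [^]\<^bsub>?K\<^esub> (2::nat))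
        = h u [^]\<^bsub>?K\<^esub> (2::nat) \<longleftrightarrow> (\<lambda>i. a * (s i)\<^sup>2 + b * (t i)\<^sup>2 - (u i)\<^sup>2) \<in> ?I"
    if "padic_Cauchy p s" "padic_Cauchy p t" "padic_Cauchy p u" for s t u
  proof -
    have "h (\<lambda>i. q) \<otimes>\<^bsub>?K\<^esub> h v [^]\<^bsub>?K\<^esub> (2::nat) = h (\<lambda>i. q * (v i)\<^sup>2)" if "padic_Cauchy p v" for q v
    proof -
      have "(\<lambda>i. q) \<in> carrier ?R" "v \<in> carrier ?R"
        using that p by (simp_all add: carr)
      hence "h (\<lambda>i. q) \<otimes>\<^bsub>?K\<^esub> h v [^]\<^bsub>?K\<^esub> (2::nat) = h ((\<lambda>i. q) \<otimes>\<^bsub>?R\<^esub> v [^]\<^bsub>?R\<^esub> (2::nat))"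
        by (simp add: h.hom_nat_pow)
      thus ?thesis
        using that by (simp add: sq mult)
    qed
    moreover have "h u [^]\<^bsub>?K\<^esub> (2::nat) = h (\<lambda>i. (u i)\<^sup>2)"
      using that(3) by (simp add: carr h.hom_nat_pow flip: sq)
    moreover have "h (\<lambda>i. a * (s i)\<^sup>2) \<oplus>\<^bsub>?K\<^esub> h (\<lambda>i. b * (t i)\<^sup>2) = h (\<lambda>i. a * (s i)\<^sup>2 + b * (t i)\<^sup>2)"
      using C that by (simp add: carr flip: add)
    ultimately show ?thesis
      using that p by (simp add: eq C padic_Cauchy_add)
  qed
  define Q where "Q = (\<lambda>X Y Z. (X, Y, Z) \<noteq> (\<zero>\<^bsub>?K\<^esub>, \<zero>\<^bsub>?K\<^esub>, \<zero>\<^bsub>?K\<^esub>) \<and>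
    (h (\<lambda>i. a) \<otimes>\<^bsub>?K\<^esub> X [^]\<^bsub>?K\<^esub> (2::nat)) \<oplus>\<^bsub>?K\<^esub> (h (\<lambda>i. b) \<otimes>\<^bsub>?K\<^esub> Y [^]\<^bsub>?K\<^esub> (2::nat))
      = Z [^]\<^bsub>?K\<^esub> (2::nat))"
  have "Hilbert_symbol a b p = (if \<exists>X\<in>carrier ?K. \<exists>Y\<in>carrier ?K. \<exists>Z\<in>carrier ?K. Q X Y Z then 1 else - 1)"
    unfolding Hilbert_symbol_def Let_def padic_field_def padic_of_rat_def Q_def h_def by (rule refl)
  hence "Hilbert_symbol a b p = 1 \<longleftrightarrow> (\<exists>X\<in>carrier ?K. \<exists>Y\<in>carrier ?K. \<exists>Z\<in>carrier ?K. Q X Y Z)"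
    by (simp only: split: if_split) simp
  also have "\<dots> \<longleftrightarrow> (\<exists>s t u. padic_Cauchy p s \<and> padic_Cauchy p t \<and> padic_Cauchy p u \<and> Q (h s) (h t) (h u))"
    unfolding carrK by blast
  also have "\<dots> \<longleftrightarrow> (\<exists>s t u. padic_Cauchy p s \<and> padic_Cauchy p t \<and> padic_Cauchy p u \<and>
       \<not> (s \<in> padic_null p \<and> t \<in> padic_null p \<and> u \<in> padic_null p) \<and>
       (\<lambda>i. a * (s i)\<^sup>2 + b * (t i)\<^sup>2 - (u i)\<^sup>2) \<in> padic_null p)"
    by (intro iff_exI conj_cong refl) (simp only: Q_def prod.inject zero equation)
  finally show ?thesis .
qed

section \<open>Absolute values of sums of two squares\<close>

lemma padic_abs_eq_powi:
  assumes "q \<noteq> 0"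
  obtains k where "padic_abs p q = real p powi k"
  using assms by (simp add: padic_abs_def)

text \<open>For t = r / s in lowest terms, the bound makes s prime to p. Then p cannot divide r^2 +
  s^2, since it would divide s; so 1 + t^2 = (r^2 + s^2) / s^2 is a quotient of p-adic
  units.\<close>

lemma padic_abs_one_plus_square:
  assumes p: "prime p" "p mod 4 = 3" and t: "padic_abs p t \<le> 1"
  shows "padic_abs p (1 + t\<^sup>2) = 1"
proof -
  obtain r s where rs: "quotient_of t = (r, s)"
    by fastforce
  have s: "s > 0" and eq: "t = of_int r / of_int s" and cop: "coprime r s"
    using quotient_of_denom_pos[OF rs] quotient_of_div[OF rs] quotient_of_coprime[OF rs] by auto
  have ps: "\<not> int p dvd s"
  proof
    assume dvd: "int p dvd s"
    have "\<not> int p dvd r"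
      using cop dvd p(1) by (metis coprime_common_divisor not_prime_unit prime_nat_int_transfer)
    hence "t \<noteq> 0" "multiplicity (int p) r = 0"
      using eq s by (auto simp: not_dvd_imp_multiplicity_0)
    moreover have "multiplicity (int p) s > 0"
      using dvd s p(1) by (simp add: prime_multiplicity_gt_zero_iff)
    ultimately have "padic_val p t < 0"
      by (simp add: padic_val_def rs)
    hence "padic_abs p t > 1"
      using \<open>t \<noteq> 0\<close> prime_gt_1_nat[OF p(1)] by (simp add: padic_abs_def one_less_power_int)
    with t show False
      by simp
  qed
  hence unit: "padic_abs p (of_int s) = 1"
    using s padic_val_divide[OF p(1), of s 1] by (simp add: padic_abs_def not_dvd_imp_multiplicity_0)
  have "\<not> int p dvd r\<^sup>2 + s\<^sup>2"
    using ps prime_dvd_sum_squares_imp_dvd[OF p] by blast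
  moreover have "r\<^sup>2 + s\<^sup>2 \<noteq> 0"
    using s by (simp add: sum_power2_eq_zero_iff)
  ultimately have "padic_abs p (of_int (r\<^sup>2 + s\<^sup>2)) = 1"
    using padic_val_divide[OF p(1), of "r\<^sup>2 + s\<^sup>2" 1]
    by (simp add: padic_abs_def not_dvd_imp_multiplicity_0 del: of_int_add of_int_power)
  also have "of_int (r\<^sup>2 + s\<^sup>2) = (1 + t\<^sup>2) * (of_int s * of_int s)"
    using s by (simp add: eq field_simps power2_eq_square)
  finally show ?thesis
    by (simp add: padic_abs_mult[OF p(1)] unit)
qed

text \<open>No cancellation occurs because -1 is not a square modulo p: dividing by the square of
  the larger entry reduces the claim to 1 + t^2 with |t|_p \<le> 1.\<close>

lemma padic_abs_sum_squares:
  assumes p: "prime p" "p mod 4 = 3"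
  shows "padic_abs p (a\<^sup>2 + b\<^sup>2) = (max (padic_abs p a) (padic_abs p b))\<^sup>2"
proof -
  have main: "padic_abs p (a\<^sup>2 + b\<^sup>2) = (padic_abs p b)\<^sup>2" if le: "padic_abs p a \<le> padic_abs p b" for a b
  proof (cases "b = 0")
    case True
    have "padic_abs p a = 0"
      using le True padic_abs_nonneg[of p a] by simp
    hence "a = 0"
      by (simp add: padic_abs_eq_0_iff[OF p(1)])
    with True show ?thesis
      by simp
  next
    case False
    have b: "padic_abs p b > 0"
      using False padic_abs_eq_0_iff[OF p(1), of b] padic_abs_nonneg[of p b] by linarith
    have "padic_abs p a = padic_abs p (a / b) * padic_abs p b"
      using False by (simp flip: padic_abs_mult[OF p(1)])
    hence "padic_abs p (a / b) \<le> 1"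
      using le b by simp
    hence "padic_abs p (1 + (a / b)\<^sup>2) = 1"
      by (rule padic_abs_one_plus_square[OF p])
    moreover have "a\<^sup>2 + b\<^sup>2 = (1 + (a / b)\<^sup>2) * (b * b)"
      using False by (simp add: field_simps power2_eq_square)
    ultimately show ?thesis
      by (simp add: padic_abs_mult[OF p(1)] power2_eq_square)
  qed
  show ?thesis
    using main[of a b] main[of b a] by (cases "padic_abs p a \<le> padic_abs p b") (auto simp: add.commute max_def)
qed

text \<open>The two terms have valuations of different parity, so they cannot cancel.\<close>
lemma padic_abs_odd_times_sum_squares_diff:
  assumes p: "prime p" "p mod 4 = 3" and n: "n \<noteq> 0" "odd (padic_val p n)"
  shows "padic_abs p (n * (a\<^sup>2 + b\<^sup>2) - c\<^sup>2) =
           max (padic_abs p n * (max (padic_abs p a) (padic_abs p b))\<^sup>2) ((padic_abs p c)\<^sup>2)"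
proof -
  let ?u = "n * (a\<^sup>2 + b\<^sup>2)" and ?w = "c\<^sup>2"
  have u: "padic_abs p ?u = padic_abs p n * (max (padic_abs p a) (padic_abs p b))\<^sup>2"
    by (simp add: padic_abs_mult[OF p(1)] padic_abs_sum_squares[OF p])
  have w: "padic_abs p ?w = (padic_abs p c)\<^sup>2"
    by (simp add: power2_eq_square padic_abs_mult[OF p(1)])
  have p1: "real p > 1"
    using prime_gt_1_nat[OF p(1)] by simp
  have "padic_abs p (?u - ?w) = max (padic_abs p ?u) (padic_abs p ?w)"
  \<comment> \<open>A vanishing term is treated apart, because its absolute value 0 is not a power
    of p.\<close>
  proof (cases "a\<^sup>2 + b\<^sup>2 = 0 \<or> c = 0")
    case True
    thus ?thesis
      by (auto simp: max_def padic_abs_eq_0_iff[OF p(1)] intro: antisym)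
  next
    case False
    \<comment> \<open>Whichever of a and b attains the maximum; it is nonzero, so the maximum is an
      integral power of p and has an exponent to compare.\<close>
    define d where "d = (if padic_abs p a \<le> padic_abs p b then b else a)"
    have d: "max (padic_abs p a) (padic_abs p b) = padic_abs p d"
      by (simp add: d_def max_def)
    have "d \<noteq> 0"
      using False d padic_abs_sum_squares[OF p, of a b] padic_abs_eq_0_iff[OF p(1), of "a\<^sup>2 + b\<^sup>2"]
      by auto
    have "padic_abs p ?u \<noteq> padic_abs p ?w"
    proof
      assume eq: "padic_abs p ?u = padic_abs p ?w"
      obtain k where k: "padic_abs p d = real p powi k"
        using padic_abs_eq_powi[OF \<open>d \<noteq> 0\<close>] .
      obtain l where l: "padic_abs p c = real p powi l"
        using padic_abs_eq_powi False by blast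
      have "real p \<noteq> 0"
        using p1 by simp
      note powi_add = power_int_add[OF disjI1[OF this]]
      have "padic_abs p n = real p powi (- padic_val p n)"
        using n(1) by (simp add: padic_abs_def)
      with eq have "real p powi (- padic_val p n + (k + k)) = real p powi (l + l)"
        unfolding u w d k l by (simp only: powi_add power2_eq_square)
      hence "- padic_val p n + (k + k) = l + l"
        using p1 power_int_strict_increasing[of _ _ "real p"] by (metis linorder_neq_iff)
      hence "even (padic_val p n)"
        by presburger
      with n(2) show False
        by simp
    qed
    \<comment> \<open>In an ultrametric triangle the two longest sides are equal; as
      \<open>?u\<close> and \<open>?w\<close> differ in absolute value, their difference is as large
      as the larger one.\<close>
    moreover have "padic_abs p ?u \<le> max (padic_abs p (?u - ?w)) (padic_abs p ?w)"
      using padic_abs_add[OF p(1), of "?u - ?w" ?w] by simp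
    moreover have "padic_abs p ?w \<le> max (padic_abs p ?u) (padic_abs p (?u - ?w))"
      using padic_abs_diff[OF p(1), of ?u "?u - ?w"] by simp
    moreover have "padic_abs p (?u - ?w) \<le> max (padic_abs p ?u) (padic_abs p ?w)"
      by (rule padic_abs_diff[OF p(1)])
    ultimately show ?thesis
      by (auto simp: max_def split: if_splits)
  qed
  thus ?thesis
    by (simp only: u w)
qed

section \<open>Values of the Hilbert symbol\<close>

text \<open>Dividing by c and squeezing, |t|^2 tends to 0, hence so does |t|. This passes from a
  null value of a form to null variables.\<close>

lemma padic_nullI_square:
  assumes p: "prime p" and s: "s \<in> padic_null p" and c: "c > 0"
    and le: "\<And>i. c * (padic_abs p (t i))\<^sup>2 \<le> padic_abs p (s i)"
  shows "t \<in> padic_null p"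
proof -
  have "(\<lambda>i. padic_abs p (s i) / c) \<longlonglongrightarrow> 0 / c"
    using s c by (intro tendsto_divide tendsto_const) (simp_all add: padic_null_def)
  hence lim: "(\<lambda>i. padic_abs p (s i) / c) \<longlonglongrightarrow> 0"
    by simp
  have "(padic_abs p (t i))\<^sup>2 \<le> padic_abs p (s i) / c" for i
    using le[of i] c by (simp add: field_simps)
  hence "(\<lambda>i. (padic_abs p (t i))\<^sup>2) \<longlonglongrightarrow> 0"
    by (intro tendsto_sandwich[OF _ _ tendsto_const lim]) simp_all
  thus ?thesis
    by (simp add: padic_null_def)
qed

text \<open>A solution would make n (s^2 + (x t)^2) - u^2 null. Its terms do not cancel, so its
  absolute value dominates |n| |s|^2, |n| |x t|^2 and |u|^2, and all three variables would be
  null.\<close>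

lemma Hilbert_symbol_odd_valuation:
  assumes p: "prime p" "p mod 4 = 3" and n: "n \<noteq> 0" "odd (padic_val p n)" and x: "x \<noteq> 0"
  shows "Hilbert_symbol n (n * x\<^sup>2) p \<noteq> 1"
proof
  assume "Hilbert_symbol n (n * x\<^sup>2) p = 1"
  then obtain s t u where C: "padic_Cauchy p s" "padic_Cauchy p t" "padic_Cauchy p u"
    and nonnull: "\<not> (s \<in> padic_null p \<and> t \<in> padic_null p \<and> u \<in> padic_null p)"
    and null: "(\<lambda>i. n * (s i)\<^sup>2 + n * x\<^sup>2 * (t i)\<^sup>2 - (u i)\<^sup>2) \<in> padic_null p"
    using Hilbert_symbol_eq_1_iff[OF p(1)] by blast
  define d where "d = (\<lambda>i. n * ((s i)\<^sup>2 + (x * t i)\<^sup>2) - (u i)\<^sup>2)"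
  have d: "d \<in> padic_null p"
    using null by (simp add: d_def power_mult_distrib algebra_simps)
  have pn: "padic_abs p n > 0"
    using n padic_abs_eq_0_iff[OF p(1), of n] padic_abs_nonneg[of p n] by linarith
  have val: "padic_abs p (d i) = max (padic_abs p n * (max (padic_abs p (s i)) (padic_abs p (x * t i)))\<^sup>2)
      ((padic_abs p (u i))\<^sup>2)" for i
    unfolding d_def by (rule padic_abs_odd_times_sum_squares_diff[OF p n])
  have "s \<in> padic_null p"
    using pn by (intro padic_nullI_square[OF p(1) d pn])
      (auto simp: val le_max_iff_disj intro!: mult_left_mono power_mono)
  moreover have xt: "(\<lambda>i. x * t i) \<in> padic_null p"
    using pn by (intro padic_nullI_square[OF p(1) d pn])
      (auto simp: val le_max_iff_disj intro!: mult_left_mono power_mono)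
  have "(\<lambda>i. (1 / x) * (x * t i)) \<in> padic_null p"
    by (rule padic_null_mult[OF p(1) padic_Cauchy_const[OF p(1)] xt])
  hence "t \<in> padic_null p"
    using x by (simp add: field_simps)
  moreover have "u \<in> padic_null p"
    by (intro padic_nullI_square[OF p(1) d, of 1]) (auto simp: val)
  ultimately show False
    using nonnull by blast
qed

lemma const_notin_padic_null:
  assumes "prime p" "q \<noteq> 0"
  shows "(\<lambda>i. q) \<notin> padic_null p"
  using assms by (simp add: padic_null_def LIMSEQ_const_iff padic_abs_eq_0_iff)

text \<open>With s a p-adic square root of -1, the binary form itself vanishes at (x s, 1), so the
  third coordinate can be 0.\<close>

lemma Hilbert_symbol_mod_4_eq_1:
  assumes p: "prime p" "p mod 4 = 1" and x: "x \<noteq> 0"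
  shows "Hilbert_symbol n (n * x\<^sup>2) p = 1"
proof -
  have "odd p"
    using p(2) by presburger
  then obtain a where a: "[a\<^sup>2 = - 1] (mod int p)"
    using QuadRes_minus_one_iff p unfolding QuadRes_def by blast
  have "\<not> int p dvd - 1"
    using prime_gt_1_nat[OF p(1)] by simp
  hence "\<not> int p dvd a"
    using a not_dvd_if_square_cong by blast
  then obtain s where s: "padic_Cauchy p s" "(\<lambda>i. (s i)\<^sup>2 - of_int (- 1)) \<in> padic_null p"
    using padic_sqrt_exists[OF p(1) \<open>odd p\<close> a] by blast
  have "(\<lambda>i. n * x\<^sup>2 * ((s i)\<^sup>2 - of_int (- 1))) \<in> padic_null p"
    using p(1) s(2) by (intro padic_null_mult) simp_all
  hence "(\<lambda>i. n * (x * s i)\<^sup>2 + n * x\<^sup>2 * 1\<^sup>2 - 0\<^sup>2) \<in> padic_null p"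
    by (simp add: algebra_simps power_mult_distrib)
  moreover have "padic_Cauchy p (\<lambda>i. x * s i)"
    using p(1) s(1) by (intro padic_Cauchy_mult) simp_all
  ultimately show ?thesis
    unfolding Hilbert_symbol_eq_1_iff[OF p(1)]
    using p(1) const_notin_padic_null[OF p(1), of 1]
    by (intro exI[of _ "\<lambda>i. x * s i"] exI[of _ "\<lambda>i. 1"] exI[of _ "\<lambda>i. 0"]) simp
qed

text \<open>With $u$ the unit part of $n$, the solution is $(1, r/x, z)$ where $z$ is the $p$-adic square
  root of $n (1 + r^2)$, and $r$ is chosen so that $u (1 + r^2)$ is a square modulo $p$.\<close>
lemma Hilbert_symbol_even_multiplicity:
  fixes n :: nat
  assumes p: "prime p" "odd p" and n: "n > 0" "even (multiplicity p n)" and x: "x \<noteq> 0"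
  shows "Hilbert_symbol (of_nat n) (of_nat n * x\<^sup>2) p = 1"
proof -
  obtain w where w: "multiplicity p n = w + w"
    using n(2) by (metis evenE mult_2)
  obtain u where u: "n = p ^ multiplicity p n * u" "\<not> p dvd u"
    using multiplicity_decompose'[of n p] n(1) prime_gt_1_nat[OF p(1)] by auto
  obtain r a :: int where ra: "[a\<^sup>2 = int u * (1 + r\<^sup>2)] (mod int p)" "\<not> int p dvd a"
    using ex_quadratic_residue_times_one_plus_square[OF p, of "int u"] u(2) by auto
  obtain s where s: "padic_Cauchy p s" "(\<lambda>i. (s i)\<^sup>2 - of_int (int u * (1 + r\<^sup>2))) \<in> padic_null p"
    using padic_sqrt_exists[OF p ra] by blast
  \<comment> \<open>Hence n (1 + r^2) is u (1 + r^2) times the square of p^w, and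
    \<open>of_nat p ^ w * s i\<close> represents its square root.\<close>
  have n': "(of_nat n :: rat) = (of_nat p ^ w)\<^sup>2 * of_nat u"
    by (subst u(1)) (simp add: w power_add power2_eq_square)
  have "(\<lambda>i. - ((of_nat p ^ w)\<^sup>2) * ((s i)\<^sup>2 - of_int (int u * (1 + r\<^sup>2)))) \<in> padic_null p"
    using p(1) s(2) by (intro padic_null_mult) simp_all
  hence "(\<lambda>i. of_nat n * 1\<^sup>2 + of_nat n * x\<^sup>2 * (of_int r / x)\<^sup>2 - (of_nat p ^ w * s i)\<^sup>2) \<in> padic_null p"
    using x by (simp add: n' algebra_simps power_mult_distrib power_divide)
  moreover have "padic_Cauchy p (\<lambda>i. of_nat p ^ w * s i)"
    using p(1) s(1) by (intro padic_Cauchy_mult) simp_all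
  ultimately show ?thesis
    unfolding Hilbert_symbol_eq_1_iff[OF p(1)]
    using p(1) const_notin_padic_null[OF p(1), of 1]
    by (intro exI[of _ "\<lambda>i. 1"] exI[of _ "\<lambda>i. of_int r / x"] exI[of _ "\<lambda>i. of_nat p ^ w * s i"]) simp
qed

lemma padic_val_of_nat:
  assumes p: "prime p" and n: "n > 0"
  shows "padic_val p (of_nat n) = int (multiplicity p n)"
proof -
  have "\<not> p ^ Suc (multiplicity p n) dvd n"
    using multiplicity_geI[of n p "Suc (multiplicity p n)"] n prime_gt_1_nat[OF p] by auto
  hence "multiplicity (int p) (int n) = multiplicity p n"
    by (intro multiplicity_eqI) (simp_all add: multiplicity_dvd flip: of_nat_power of_nat_mult)
  thus ?thesis
    using padic_val_divide[OF p, of "int n" 1] n by simp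
qed

lemma Hilbert_symbol_eq_1_iff_even:
  fixes n :: nat
  assumes p: "prime p" "odd p" and n: "n > 0" and x: "x \<noteq> 0"
  shows "Hilbert_symbol (of_nat n) (of_nat n * x\<^sup>2) p = 1 \<longleftrightarrow>
           p mod 4 = 1 \<or> even (multiplicity p n)"
proof -
  have "p mod 4 = 1 \<or> p mod 4 = 3"
    using p(2) by presburger
  thus ?thesis
    using Hilbert_symbol_mod_4_eq_1[of p] Hilbert_symbol_even_multiplicity[OF p n]
      Hilbert_symbol_odd_valuation[of p "of_nat n"] assms by (auto simp: padic_val_of_nat)
qed

lemma Hilbert_symbol_cases: "Hilbert_symbol a b p = 1 \<or> Hilbert_symbol a b p = - 1"
  by (simp add: Hilbert_symbol_def Let_def)

section \<open>Similarity and sums of two squares\<close>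

text \<open>The (1, 1) entry of the matrix product is the value of the second form at the first
  column of A, so n is represented by that form, and y is absorbed into a variable. Conversely, one
  representation of n already determines a suitable A.\<close>

lemma similar_diag_form_iff_sum_two_squares:
  assumes m: "m \<noteq> 0" and n: "n \<noteq> 0" and x: "x \<noteq> 0" and y: "y \<noteq> 0"
  shows "similar_over_Q (diag_form n (n * x\<^sup>2)) (diag_form m (m * y\<^sup>2)) \<longleftrightarrow>
           (\<exists>a b. n = m * (a\<^sup>2 + b\<^sup>2))"
proof
  assume "similar_over_Q (diag_form n (n * x\<^sup>2)) (diag_form m (m * y\<^sup>2))"
  then obtain A where A: "transpose A ** diag_form m (m * y\<^sup>2) ** A = diag_form n (n * x\<^sup>2)"
    unfolding similar_over_Q_def by blast
  have "(transpose A ** diag_form m (m * y\<^sup>2) ** A) $ 1 $ 1 = n"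
    unfolding A by (simp add: diag_form_def)
  hence "n = m * ((A $ 1 $ 1)\<^sup>2 + (y * A $ 2 $ 1)\<^sup>2)"
    by (simp add: matrix_matrix_mult_def transpose_def diag_form_def sum_2 algebra_simps power2_eq_square)
  thus "\<exists>a b. n = m * (a\<^sup>2 + b\<^sup>2)"
    by blast
next
  assume "\<exists>a b. n = m * (a\<^sup>2 + b\<^sup>2)"
  then obtain a b where ab: "n = m * (a\<^sup>2 + b\<^sup>2)"
    by blast
  \<comment> \<open>The matrix of multiplication by a + b i, which scales the norm by a^2 + b^2,
    with diag(1, 1 / y) on its left and diag(1, x) on its right.\<close>
  define A :: "rat^2^2" where "A = vector [vector [a, - b * x], vector [b / y, a * x / y]]"
  have "det A = (a\<^sup>2 + b\<^sup>2) * x / y"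
    using y by (simp add: A_def det_2 field_simps power2_eq_square)
  hence "invertible A"
    using ab n x y by (simp add: invertible_det_nz)
  moreover have "transpose A ** diag_form m (m * y\<^sup>2) ** A = diag_form n (n * x\<^sup>2)"
    using y unfolding ab
    by (simp add: vec_eq_iff forall_2 matrix_matrix_mult_def transpose_def diag_form_def A_def sum_2
        field_simps power2_eq_square)
  ultimately show "similar_over_Q (diag_form n (n * x\<^sup>2)) (diag_form m (m * y\<^sup>2))"
    unfolding similar_over_Q_def by blast
qed

text \<open>For N = a^2 + b^2, an odd valuation would forbid cancellation in N (a^2 + b^2) - N^2,
  which is 0.\<close>

lemma even_padic_val_sum_squares:
  assumes p: "prime p" "p mod 4 = 3" and nz: "a\<^sup>2 + b\<^sup>2 \<noteq> 0"
  shows "even (padic_val p (a\<^sup>2 + b\<^sup>2))"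
proof (rule ccontr)
  assume "odd (padic_val p (a\<^sup>2 + b\<^sup>2))"
  have "padic_abs p ((a\<^sup>2 + b\<^sup>2) * (a\<^sup>2 + b\<^sup>2) - (a\<^sup>2 + b\<^sup>2)\<^sup>2) > 0"
    unfolding padic_abs_odd_times_sum_squares_diff[OF p nz \<open>odd _\<close>, of a b "a\<^sup>2 + b\<^sup>2"]
    using nz padic_abs_eq_0_iff[OF p(1), of "a\<^sup>2 + b\<^sup>2"] by (simp add: less_max_iff_disj)
  thus False
    by (simp add: power2_eq_square)
qed

text \<open>The quotient n / m and the integer m n differ by the square m^2, so the question is
  whether m n is a sum of two squares. Valuations settle one direction, the two-squares theorem for
  integers the other.\<close>

lemma ratio_sum_two_squares_iff:
  fixes m n :: nat
  assumes m: "m > 0" and n: "n > 0"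
  shows "(\<exists>a b :: rat. of_nat n = of_nat m * (a\<^sup>2 + b\<^sup>2)) \<longleftrightarrow>
           (\<forall>p. prime p \<and> p mod 4 = 3 \<longrightarrow> (even (multiplicity p n) \<longleftrightarrow> even (multiplicity p m)))"
proof (rule iffI; (intro allI impI)?)
  fix p :: nat
  assume "\<exists>a b :: rat. of_nat n = of_nat m * (a\<^sup>2 + b\<^sup>2)" and p: "prime p \<and> p mod 4 = 3"
  then obtain a b :: rat where ab: "of_nat n = of_nat m * (a\<^sup>2 + b\<^sup>2)"
    by blast
  have mn: "of_nat (m * n) = (of_nat m * a)\<^sup>2 + (of_nat m * b)\<^sup>2"
    by (simp add: ab algebra_simps power2_eq_square)
  moreover have "of_nat (m * n) \<noteq> (0 :: rat)"
    using m n by simp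
  ultimately have "even (padic_val p (of_nat (m * n)))"
    using even_padic_val_sum_squares p by metis
  hence "even (multiplicity p (m * n))"
    using p m n padic_val_of_nat[of p "m * n"] by simp
  thus "even (multiplicity p n) \<longleftrightarrow> even (multiplicity p m)"
    using p m n by (auto simp: prime_elem_multiplicity_mult_distrib)
next
  assume "\<forall>p. prime p \<and> p mod 4 = 3 \<longrightarrow> (even (multiplicity p n) \<longleftrightarrow> even (multiplicity p m))"
  hence "even (multiplicity p (m * n))" if "prime p" "p mod 4 = 3" for p
    using that m n by (auto simp: prime_elem_multiplicity_mult_distrib)
  then obtain a b where ab: "m * n = a\<^sup>2 + b\<^sup>2"
    using sum_two_squares_if_even_multiplicity[of "m * n"] m n by auto
  have "of_nat m * of_nat n = (of_nat a)\<^sup>2 + (of_nat b :: rat)\<^sup>2"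
    using ab by (metis of_nat_add of_nat_mult of_nat_power)
  hence "of_nat n = of_nat m * ((of_nat a / of_nat m)\<^sup>2 + (of_nat b / of_nat m :: rat)\<^sup>2)"
    using m by (simp add: field_simps power2_eq_square)
  thus "\<exists>a b :: rat. of_nat n = of_nat m * (a\<^sup>2 + b\<^sup>2)"
    by blast
qed

theorem theorem2p14:
  fixes m n x y :: nat
  assumes "m > 0" and "n > 0" and "x > 0" and "y > 0"
  shows "similar_over_Q (diag_form (of_nat n) (of_nat (n * x\<^sup>2)))
                        (diag_form (of_nat m) (of_nat (m * y\<^sup>2))) \<longleftrightarrow>
         (\<forall>p::nat. prime p \<and> odd p \<longrightarrow>
            Hilbert_symbol (of_nat n) (of_nat (n * x\<^sup>2)) p =
            Hilbert_symbol (of_nat m) (of_nat (m * y\<^sup>2)) p)"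
proof -
  \<comment> \<open>The symbol takes only the values 1 and -1, so two symbols agree iff their
    conditions for the value 1 do; for p mod 4 = 1 both hold.\<close>
  have symbols: "Hilbert_symbol (of_nat n) (of_nat (n * x\<^sup>2)) p = Hilbert_symbol (of_nat m) (of_nat (m * y\<^sup>2)) p
      \<longleftrightarrow> p mod 4 = 1 \<or> (even (multiplicity p n) \<longleftrightarrow> even (multiplicity p m))"
    if p: "prime p" "odd p" for p
    using Hilbert_symbol_eq_1_iff_even[OF p, of n "of_nat x"] Hilbert_symbol_eq_1_iff_even[OF p, of m "of_nat y"]
      Hilbert_symbol_cases[of "of_nat n" "of_nat (n * x\<^sup>2)" p]
      Hilbert_symbol_cases[of "of_nat m" "of_nat (m * y\<^sup>2)" p] assms
    by auto
  \<comment> \<open>Among the odd primes only those with p mod 4 = 3 impose a condition, and every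
    such prime is odd.\<close>
  have "p mod 4 = 1 \<longleftrightarrow> p mod 4 \<noteq> 3" if "odd p" for p :: nat
    using that by presburger
  moreover have "odd p" if "p mod 4 = 3" for p :: nat
    using that by presburger
  ultimately have "(\<forall>p. prime p \<and> odd p \<longrightarrow>
      Hilbert_symbol (of_nat n) (of_nat (n * x\<^sup>2)) p = Hilbert_symbol (of_nat m) (of_nat (m * y\<^sup>2)) p)
      \<longleftrightarrow> (\<forall>p. prime p \<and> p mod 4 = 3 \<longrightarrow> (even (multiplicity p n) \<longleftrightarrow> even (multiplicity p m)))"
    using symbols by metis
  thus ?thesis
    using similar_diag_form_iff_sum_two_squares[of "of_nat m" "of_nat n" "of_nat x" "of_nat y"]
      ratio_sum_two_squares_iff[OF assms(1,2)] assms by simp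
qed

end
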